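(* The sequence $(\#\mathrm{Av}_n(213))_{n\ge0}=(C_n)_{n\ge0}$ is log-convex, i.e. $(\#\mathrm{Av}_n(213))^2\le\#\mathrm{Av}_{n-1}(213)\cdot\#\mathrm{Av}_{n+1}(213)$ for all $n\ge1$.
   Context: $\mathfrak S_n$ is the set of permutations of $\{1,\ldots,n\}$ in one-line notation. A permutation $\pi\in\mathfrak S_n$ contains $\sigma\in\mathfrak S_k$ as a classical pattern if there is a (not necessarily consecutive) subsequence $\pi_{i_1}\pi_{i_2}\ldots\pi_{i_k}$ of $\pi$ with $i_1<\cdots<i_k$ whose elements are in the same relative order as those of $\sigma$. $\mathrm{Av}_n(\sigma)$ is the set of $\pi\in\mathfrak S_n$ that do not contain $\sigma$. $C_n=\frac1{n+1}\binom{2n}{n}$ is the $n$th Catalan number; it is well known that $\#\mathrm{Av}_n(\sigma)=C_n$ for every $\sigma\in\mathfrak S_3$. *)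

theory Defs
  imports Complex_Main "HOL-Library.Sublist" "HOL-Combinatorics.Multiset_Permutations"
begin

text \<open>
  A permutation of \<open>{1..n}\<close> is represented by its one-line notation, i.e. by an element
  of \<^term>\<open>permutations_of_set {1..n}\<close>.
\<close>

definition order_isomorphic :: "nat list \<Rightarrow> nat list \<Rightarrow> bool" where
  "order_isomorphic xs ys \<longleftrightarrow>
     length xs = length ys \<and>
     (\<forall>i<length xs. \<forall>j<length xs. xs ! i < xs ! j \<longleftrightarrow> ys ! i < ys ! j)"

definition contains_pattern :: "nat list \<Rightarrow> nat list \<Rightarrow> bool" where
  "contains_pattern \<pi> \<sigma> \<longleftrightarrow> (\<exists>xs. subseq xs \<pi> \<and> order_isomorphic xs \<sigma>)"

definition Av :: "nat \<Rightarrow> nat list \<Rightarrow> nat list set" where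
  "Av n \<sigma> = {\<pi> \<in> permutations_of_set {1..n}. \<not> contains_pattern \<pi> \<sigma>}"

definition catalan :: "nat \<Rightarrow> real" where
  "catalan n = 1 / (real n + 1) * real ((2 * n) choose n)"

text \<open>No positivity is required of \<open>a\<close>; the sequence is indexed from \<open>0\<close>.\<close>

definition log_convex :: "(nat \<Rightarrow> real) \<Rightarrow> bool" where
  "log_convex a \<longleftrightarrow> (\<forall>n\<ge>1. (a n)\<^sup>2 \<le> a (n - 1) * a (n + 1))"

end

theory Submission
  imports Defs "HOL-Computational_Algebra.Formal_Power_Series"
begin

text \<open>
  If a permutation \<open>x # xs\<close> avoids \<open>213\<close>, then an entry below \<open>x\<close> cannot be followed by an
  entry above \<open>x\<close>, since \<open>x\<close> would complete these two to a \<open>213\<close>.  So all entries above \<open>x\<close>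
  come before all entries below \<open>x\<close>, and the permutation is \<open>x # us @ vs\<close> with every entry of
  \<open>vs\<close> below \<open>x\<close> and every entry of \<open>us\<close> above it.  Conversely, such a word avoids \<open>213\<close> as soon
  as \<open>us\<close> and \<open>vs\<close> do (\<open>contains_213_first_split\<close>): \<open>x\<close> starts no occurrence because nothing above
  it follows anything below it, and an occurrence with letters in both \<open>us\<close> and \<open>vs\<close> would have
  its last letter in \<open>vs\<close>, although this letter is its largest.  The number of admissible \<open>us\<close> and
  \<open>vs\<close> depends only on their lengths, so summing over \<open>x\<close> gives Segner's recurrence
  \<open>C\<^sub>n\<^sub>+\<^sub>1 = (\<Sum>k\<le>n. C\<^sub>k C\<^sub>n\<^sub>-\<^sub>k)\<close>.

  For the generating function this recurrence is \<open>c = 1 + X c\<^sup>2\<close>, that is,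
  \<open>D\<^sup>2 = 1 - 4 X\<close> for \<open>D = 1 - 2 X c\<close>.  Differentiating and multiplying by \<open>D\<close> turns this
  into the linear equation \<open>D' (1 - 4 X) = - 2 D\<close>, whose coefficients say
  \<open>(n + 2) C\<^sub>n\<^sub>+\<^sub>1 = (4 n + 2) C\<^sub>n\<close> (\<open>segner_imp_ratio\<close>).  The Catalan numbers satisfy the same
  first-order recurrence, which gives the enumeration, and log-convexity follows because the
  quotient \<open>C\<^sub>n\<^sub>+\<^sub>1 / C\<^sub>n = 4 - 6 / (n + 2)\<close> increases with \<open>n\<close>.
\<close>

section \<open>Splitting a 213-avoiding word at its first letter\<close>

lemma contains_213_iff:
  "contains_pattern xs [2, 1, 3] \<longleftrightarrow> (\<exists>b a c. subseq [b, a, c] xs \<and> a < b \<and> b < c)"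
proof
  assume "contains_pattern xs [2, 1, 3]"
  then obtain ys where ys: "subseq ys xs" "order_isomorphic ys [2, 1, 3]"
    by (auto simp: contains_pattern_def)
  then have "length ys = 3" by (simp add: order_isomorphic_def)
  then obtain b a c where eq: "ys = [b, a, c]"
    by (auto simp: length_Suc_conv numeral_3_eq_3)
  have "a < b" "b < c"
    using ys(2) unfolding eq order_isomorphic_def
    by (auto simp: All_less_Suc numeral_3_eq_3)
  with ys(1) eq show "\<exists>b a c. subseq [b, a, c] xs \<and> a < b \<and> b < c" by blast
next
  assume "\<exists>b a c. subseq [b, a, c] xs \<and> a < b \<and> b < c"
  then obtain b a c where "subseq [b, a, c] xs" "a < b" "b < c" by blast
  moreover from this have "order_isomorphic [b, a, c] [2, 1, 3]"
    by (auto simp: order_isomorphic_def All_less_Suc)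
  ultimately show "contains_pattern xs [2, 1, 3]"
    by (auto simp: contains_pattern_def)
qed

lemma contains_213_Cons:
  "contains_pattern (x # xs) [2, 1, 3] \<longleftrightarrow>
     contains_pattern xs [2, 1, 3] \<or> (\<exists>a c. subseq [a, c] xs \<and> a < x \<and> x < c)"
  (is "?L \<longleftrightarrow> ?R")
proof
  assume ?L
  then obtain b a c where "subseq [b, a, c] (x # xs)" "a < b" "b < c"
    unfolding contains_213_iff by blast
  then show ?R
    unfolding contains_213_iff by (cases "b = x") (auto simp: subseq_Cons2_iff)
next
  assume ?R
  then show ?L
    unfolding contains_213_iff by (blast intro: list_emb_Cons list_emb_Cons2)
qed

text \<open>
  The word is sorted into two blocks: once a letter below \<open>x\<close> has occurred, no letter above \<open>x\<close>
  may follow.  Writing the blocks as filters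
  says which letters they contain.
\<close>

lemma large_before_small:
  fixes x :: nat
  assumes "\<not> (\<exists>a c. subseq [a, c] xs \<and> a < x \<and> x < c)" and "x \<notin> set xs"
  shows "xs = filter ((<) x) xs @ filter (\<lambda>y. y < x) xs"
  using assms
proof (induction xs)
  case (Cons y ys)
  have IH: "ys = filter ((<) x) ys @ filter (\<lambda>z. z < x) ys"
    using Cons by (meson list.set_intros(2) list_emb_Cons)
  show ?case
  proof (cases "x < y")
    case True
    then show ?thesis using IH by auto
  next
    case False
    then have "y < x" using Cons.prems(2) by auto
    have "\<not> x < c" if "c \<in> set ys" for c
      using Cons.prems(1) \<open>y < x\<close> that by (auto simp: subseq_singleton_left)
    then have "filter ((<) x) ys = []" by (simp add: filter_empty_conv)
    then show ?thesis using IH \<open>y < x\<close> by auto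
  qed
qed simp

text \<open>
  Each letter of \<open>vs\<close> is smaller than \<open>x\<close> and than every letter of \<open>us\<close>.  As the last letter of a
  \<open>213\<close> is its largest one, an occurrence ending in \<open>vs\<close> lies in \<open>vs\<close> entirely; one ending in \<open>us\<close>
  cannot start with \<open>x\<close>, for then its middle letter would be below \<open>x\<close>.
\<close>

lemma contains_213_first_split:
  assumes us: "\<And>u. u \<in> set us \<Longrightarrow> x < u" and vs: "\<And>v. v \<in> set vs \<Longrightarrow> v < x"
  shows "contains_pattern (x # us @ vs) [2, 1, 3] \<longleftrightarrow>
           contains_pattern us [2, 1, 3] \<or> contains_pattern vs [2, 1, 3]"
    (is "?L \<longleftrightarrow> ?R")
proof
  assume ?R
  then show ?L
    unfolding contains_pattern_def
    by (blast intro: list_emb_Cons list_emb_append2 subseq_order.trans[OF _ list_emb_prefix])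
next
  assume ?L
  then consider (tail) b a c where "subseq [b, a, c] (us @ vs)" "a < b" "b < c"
    | (head) a c where "subseq [a, c] (us @ vs)" "a < x" "x < c"
    unfolding contains_213_Cons unfolding contains_213_iff by blast
  then show ?R
  proof cases
    case tail
    obtain ps qs where split: "[b, a, c] = ps @ qs" "subseq ps us" "subseq qs vs"
      using tail(1) by (auto simp: subseq_append_iff)
    have "set ps \<subseteq> set us" "set qs \<subseteq> set vs"
      using split by (auto dest: list_emb_set)
    then have lt: "q < p" if "p \<in> set ps" "q \<in> set qs" for p q
      using us vs that by (meson less_trans subsetD)
    from split(1) consider "ps = []" "qs = [b, a, c]" | "b \<in> set ps" "c \<in> set qs"
      | "ps = [b, a, c]" "qs = []"
      by (auto simp: Cons_eq_append_conv)
    then show ?thesis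
    proof cases
      case 1
      with split tail show ?thesis unfolding contains_213_iff by blast
    next
      case 2
      with lt tail(3) show ?thesis by (meson less_asym)
    next
      case 3
      with split tail show ?thesis unfolding contains_213_iff by blast
    qed
  next
    case head
    obtain ps qs where split: "[a, c] = ps @ qs" "subseq ps us" "subseq qs vs"
      using head(1) by (auto simp: subseq_append_iff)
    have sub: "set ps \<subseteq> set us" "set qs \<subseteq> set vs"
      using split by (auto dest: list_emb_set)
    from split(1) have "a \<in> set ps \<or> c \<in> set qs"
      by (auto simp: Cons_eq_append_conv)
    then have "x < a \<or> c < x" using sub us vs by blast
    with head show ?thesis by simp
  qed
qed

section \<open>Segner's recurrence\<close>

text \<open>
  The two parts of a split permutation live on different intervals, so the counting is done
  for permutations of arbitrary sets.
\<close>

definition avoiders :: "nat set \<Rightarrow> nat list set" where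
  "avoiders A = {xs \<in> permutations_of_set A. \<not> contains_pattern xs [2, 1, 3]}"

lemma finite_avoiders: "finite (avoiders A)"
  unfolding avoiders_def by (rule finite_subset[of _ "permutations_of_set A"]) auto

lemma avoiders_empty: "avoiders {} = {[]}"
  using contains_213_iff[of "[]"] by (auto simp: avoiders_def)

lemma avoiders_split:
  assumes "A \<noteq> {}"
  shows "avoiders A = (\<Union>x\<in>A. (\<lambda>(us, vs). x # us @ vs) `
           (avoiders {y \<in> A. x < y} \<times> avoiders {y \<in> A. y < x}))"
    (is "_ = ?R")
proof
  show "avoiders A \<subseteq> ?R"
  proof
    fix w assume w: "w \<in> avoiders A"
    with assms obtain x xs where eq: "w = x # xs"
      by (cases w) (auto simp: avoiders_def permutations_of_set_def)
    define us where "us = filter ((<) x) xs"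
    define vs where "vs = filter (\<lambda>y. y < x) xs"
    have A: "A = insert x (set xs)" "x \<notin> set xs" "distinct xs"
      using w eq by (auto simp: avoiders_def permutations_of_set_def)
    have av: "\<not> contains_pattern w [2, 1, 3]" using w by (simp add: avoiders_def)
    then have xs: "xs = us @ vs"
      unfolding eq contains_213_Cons us_def vs_def
      using large_before_small A(2) by blast
    have "\<not> contains_pattern us [2, 1, 3]" "\<not> contains_pattern vs [2, 1, 3]"
      using av contains_213_first_split[of us x vs]
      unfolding eq xs[symmetric] by (auto simp: us_def vs_def)
    moreover have "set us = {y \<in> A. x < y}" "set vs = {y \<in> A. y < x}"
      using A by (auto simp: us_def vs_def)
    moreover have "distinct us" "distinct vs" using A(3) by (auto simp: us_def vs_def)
    ultimately have "us \<in> avoiders {y \<in> A. x < y}" "vs \<in> avoiders {y \<in> A. y < x}"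
      by (auto simp: avoiders_def permutations_of_set_def)
    with A(1) show "w \<in> ?R" by (auto simp: eq xs image_iff)
  qed
  show "?R \<subseteq> avoiders A"
  proof clarsimp
    fix x us vs
    assume "x \<in> A" and "us \<in> avoiders {y \<in> A. x < y}" and "vs \<in> avoiders {y \<in> A. y < x}"
    then have parts: "set us = {y \<in> A. x < y}" "set vs = {y \<in> A. y < x}"
      "distinct us" "distinct vs"
      and "\<not> contains_pattern us [2, 1, 3]" "\<not> contains_pattern vs [2, 1, 3]"
      by (simp_all only: avoiders_def permutations_of_set_def mem_Collect_eq simp_thms)
    then have "\<not> contains_pattern (x # us @ vs) [2, 1, 3]"
      by (subst contains_213_first_split) simp_all
    moreover have "set (x # us @ vs) = A"
      unfolding set_simps set_append parts(1,2) using \<open>x \<in> A\<close> by (blast elim: linorder_neqE_nat)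
    moreover have "set us \<inter> set vs = {}" "x \<notin> set us" "x \<notin> set vs"
      unfolding parts(1,2) by auto
    then have "distinct (x # us @ vs)" using parts(3,4) by simp
    ultimately show "x # us @ vs \<in> avoiders A"
      by (simp only: avoiders_def permutations_of_set_def mem_Collect_eq simp_thms)
  qed
qed

lemma card_avoiders_split:
  assumes "finite A" and "A \<noteq> {}"
  shows "card (avoiders A) =
           (\<Sum>x\<in>A. card (avoiders {y \<in> A. x < y}) * card (avoiders {y \<in> A. y < x}))"
proof -
  let ?P = "\<lambda>x. avoiders {y \<in> A. x < y} \<times> avoiders {y \<in> A. y < x}"
  \<comment> \<open>The first letter fixes the length of \<open>us\<close>, and with it the place where the rest is cut.\<close>
  have inj: "inj_on (\<lambda>(us, vs). x # us @ vs) (?P x)" for x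
  proof (rule inj_onI, clarsimp)
    fix us vs us' vs'
    assume "us \<in> avoiders {y \<in> A. x < y}" "us' \<in> avoiders {y \<in> A. x < y}"
      and eq: "us @ vs = us' @ vs'"
    then have "length us = card {y \<in> A. x < y}" "length us' = card {y \<in> A. x < y}"
      by (auto simp: avoiders_def permutations_of_set_def distinct_card[symmetric])
    with eq show "us = us' \<and> vs = vs'" by simp
  qed
  show ?thesis
    unfolding avoiders_split[OF assms(2)]
    by (subst card_UN_disjoint)
       (auto simp: assms(1) finite_avoiders card_image[OF inj] card_cartesian_product)
qed

lemma card_avoiders_interval:
  "card (avoiders {a..<a + Suc n}) =
     (\<Sum>k\<le>n. card (avoiders {a..<a + k}) * card (avoiders {a + Suc k..<a + Suc k + (n - k)}))"
proof -
  let ?A = "{a..<a + Suc n}"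
  have "card (avoiders ?A) =
      (\<Sum>x\<in>?A. card (avoiders {y \<in> ?A. x < y}) * card (avoiders {y \<in> ?A. y < x}))"
    by (rule card_avoiders_split) auto
  also have "\<dots> =
      (\<Sum>k\<le>n. card (avoiders {a..<a + k}) * card (avoiders {a + Suc k..<a + Suc k + (n - k)}))"
  proof (rule sum.reindex_bij_witness[of _ "\<lambda>k. a + k" "\<lambda>x. x - a"])
    fix x assume x: "x \<in> ?A"
    have "{y \<in> ?A. x < y} = {a + Suc (x - a)..<a + Suc (x - a) + (n - (x - a))}"
      "{y \<in> ?A. y < x} = {a..<a + (x - a)}"
      using x by auto
    then show "card (avoiders {a..<a + (x - a)}) *
        card (avoiders {a + Suc (x - a)..<a + Suc (x - a) + (n - (x - a))}) =
        card (avoiders {y \<in> ?A. x < y}) * card (avoiders {y \<in> ?A. y < x})"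
      by (simp only: mult.commute)
  qed auto
  finally show ?thesis .
qed

text \<open>
  The recurrence for an interval refers only to the lengths of shorter intervals once these are
  known to determine the count; so translation invariance follows from the recurrence itself,
  without relabelling permutations.
\<close>

lemma card_avoiders_translate: "card (avoiders {a..<a + n}) = card (avoiders {b..<b + n})"
proof (induction n arbitrary: a b rule: less_induct)
  case (less n)
  show ?case
  proof (cases n)
    case (Suc m)
    show ?thesis
      unfolding Suc card_avoiders_interval
      by (intro sum.cong refl arg_cong2[of _ _ _ _ "(*)"] less) (auto simp: Suc)
  qed simp
qed

lemma card_Av_eq: "card (Av n [2, 1, 3]) = card (avoiders {a..<a + n})"
proof -
  have "{1..n} = {1..<1 + n}" by auto
  then have "Av n [2, 1, 3] = avoiders {1..<1 + n}" by (simp only: Av_def avoiders_def)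
  then show ?thesis using card_avoiders_translate by metis
qed

lemma card_Av_0: "card (Av 0 [2, 1, 3]) = 1"
  unfolding card_Av_eq[of _ 0] by (simp add: avoiders_empty)

lemma card_Av_Suc:
  "card (Av (Suc n) [2, 1, 3]) = (\<Sum>k\<le>n. card (Av k [2, 1, 3]) * card (Av (n - k) [2, 1, 3]))"
  using card_avoiders_interval[of 0 n] by (simp only: card_Av_eq[symmetric])

section \<open>From the convolution to a first-order recurrence\<close>

text \<open>
  The generating function \<open>c\<close> of the sequence solves a quadratic equation whose discriminant is
  \<open>1 - 4 X\<close>.  Instead of extracting a square root and expanding it, the proof differentiates the
  square \<open>D\<^sup>2\<close>; the resulting linear differential equation is the claimed recurrence.
\<close>

lemma segner_imp_ratio:
  fixes f :: "nat \<Rightarrow> real"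
  assumes f0: "f 0 = 1" and fSuc: "\<And>n. f (Suc n) = (\<Sum>k\<le>n. f k * f (n - k))"
  shows "(real n + 2) * f (Suc n) = (4 * real n + 2) * f n"
proof -
  define c where "c = Abs_fps f"
  define D where "D = 1 - 2 * fps_X * c"
  have c: "c = 1 + fps_X * c\<^sup>2"
  proof (rule fps_ext)
    fix m
    have "fps_nth (c\<^sup>2) k = f (Suc k)" for k
      by (simp add: c_def fSuc power2_eq_square fps_mult_nth atLeast0AtMost)
    then show "fps_nth c m = fps_nth (1 + fps_X * c\<^sup>2) m"
      by (cases m) (simp_all add: c_def f0)
  qed
  have "D\<^sup>2 = 1 - 4 * fps_X * (c - fps_X * c\<^sup>2)"
    unfolding D_def by algebra
  also have "c - fps_X * c\<^sup>2 = 1" using c by algebra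
  finally have D2: "D\<^sup>2 = 1 - 4 * fps_X" by simp
  have "fps_deriv (D * D) = - 4" using D2 by (simp add: power2_eq_square)
  then have "2 * (D * fps_deriv D) = 2 * (- 2)"
    by (simp add: mult.commute)
  then have "D * fps_deriv D = - 2" by (subst (asm) mult_cancel_left) simp
  then have "(1 - 4 * fps_X) * fps_deriv D = - 2 * D"
    using D2 by algebra
  \<comment> \<open>The coefficient of \<open>D\<close> at \<open>n + 1\<close> carries \<open>f n\<close>, because of the factor \<open>X\<close> in \<open>D\<close>.\<close>
  then have "fps_nth ((1 - 4 * fps_X) * fps_deriv D) (Suc n) = fps_nth (- 2 * D) (Suc n)" by simp
  moreover have "fps_nth D (Suc k) = - 2 * f k" for k
    by (simp add: D_def c_def mult.assoc numeral_fps_const)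
  ultimately show ?thesis
    by (simp add: algebra_simps numeral_fps_const neg_numeral_fps_const)
qed

lemma catalan_ratio: "(real n + 2) * catalan (Suc n) = (4 * real n + 2) * catalan n"
proof -
  \<comment> \<open>One absorption step leads from \<open>b'\<close> to \<open>m\<close>, another from \<open>m\<close> to \<open>b\<close>.\<close>
  define b where "b = (2 * n) choose n"
  define m where "m = (2 * n + 1) choose n"
  define b' where "b' = (2 * Suc n) choose Suc n"
  have "Suc (2 * n + 1) * m = (Suc (2 * n + 1) choose Suc n) * Suc n"
    unfolding m_def by (rule Suc_times_binomial_eq)
  moreover have "Suc (2 * n + 1) = 2 * Suc n" by simp
  ultimately have "2 * Suc n * m = b' * Suc n" unfolding b'_def by metis
  then have "b' = 2 * m" by (metis mult.assoc mult.commute mult_cancel2 nat.distinct(1))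
  moreover have "(2 * n + 1 - n) * m = (2 * n + 1) * ((2 * n + 1 - 1) choose n)"
    unfolding m_def by (rule binomial_absorb_comp)
  then have "Suc n * m = (2 * n + 1) * b" by (simp add: b_def)
  ultimately have "Suc n * b' = (4 * n + 2) * b" by (simp add: algebra_simps)
  then have "real (Suc n * b') = real ((4 * n + 2) * b)" by (simp only:)
  then have "real b' = (4 * real n + 2) * (1 / (real n + 1) * real b)"
    by (simp add: field_simps)
  moreover have "(real n + 2) * (1 / (real (Suc n) + 1) * real b') = real b'"
    by (simp add: field_simps)
  ultimately show ?thesis
    unfolding catalan_def b_def[symmetric] b'_def[symmetric] by (simp only:)
qed

text \<open>The quotient \<open>r k = 4 - 6 / (k + 2)\<close> of consecutive terms increases with \<open>k\<close>.\<close>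

lemma ratio_imp_log_convex:
  fixes f :: "nat \<Rightarrow> real"
  assumes ratio: "\<And>n. (real n + 2) * f (Suc n) = (4 * real n + 2) * f n"
  shows "log_convex f"
  unfolding log_convex_def
proof (intro allI impI)
  fix n :: nat assume "n \<ge> 1"
  then obtain m where n: "n = Suc m" by (cases n) auto
  define r where "r k = (4 * real k + 2) / (real k + 2)" for k
  have step: "f (Suc k) = r k * f k" for k
    using ratio[of k] by (simp add: r_def field_simps)
  have "r m \<le> r (Suc m)" and "0 \<le> r m" by (auto simp: r_def field_simps)
  then have "r m * (r m * (f m)\<^sup>2) \<le> r m * (r (Suc m) * (f m)\<^sup>2)"
    by (intro mult_left_mono mult_right_mono) auto
  then show "(f n)\<^sup>2 \<le> f (n - 1) * f (n + 1)"
    by (simp add: n step power2_eq_square mult_ac)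
qed

theorem theorem6p11:
  shows "(\<lambda>n. real (card (Av n [2, 1, 3]))) = catalan
         \<and> log_convex (\<lambda>n. real (card (Av n [2, 1, 3])))"
proof -
  let ?f = "\<lambda>n. real (card (Av n [2, 1, 3]))"
  have ratio: "(real n + 2) * ?f (Suc n) = (4 * real n + 2) * ?f n" for n
    by (rule segner_imp_ratio)
      (simp_all only: card_Av_0 card_Av_Suc of_nat_sum of_nat_mult of_nat_1)
  have "?f n = catalan n" for n
  proof (induction n)
    case 0
    show ?case unfolding card_Av_0 by (simp add: catalan_def)
  next
    case (Suc n)
    then have "(real n + 2) * ?f (Suc n) = (real n + 2) * catalan (Suc n)"
      by (simp only: ratio catalan_ratio)
    then show ?case by simp
  qed
  with ratio_imp_log_convex[OF ratio] show ?thesis by auto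
qed

end
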